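(* There exist constants $0<c\le C$ such that for all positive integers $m,n$ with $\max\{m,n\}\ge 2$, the complete bipartite graph $K_{m,n}$ admits a $2$-layered drawing whose total resolution $\rho$ satisfies $\frac{c}{\max\{m,n\}}\le\rho\le\frac{C}{\max\{m,n\}}$; that is, $K_{m,n}$ admits a $2$-layered drawing of total resolution $\Theta(\frac{1}{\max\{m,n\}})$.
   Context: $K_{m,n}$ has vertex bipartition $V_1\cup V_2$ with $|V_1|=m$, $|V_2|=n$ and all edges between $V_1$ and $V_2$. A $2$-layered drawing is a straight-line drawing (nodes at distinct points, edges as line segments between their endpoints) in which all nodes of $V_1$ lie on one line $\mathcal{L}_1$ and all nodes of $V_2$ lie on a second line $\mathcal{L}_2$ parallel to and distinct from $\mathcal{L}_1$. The angular resolution of a drawing is the smallest angle formed by two edges incident to a common node. The crossing resolution is the smallest angle formed at a crossing point of two crossing edges (the smaller of the two supplementary angles at a crossing); if there are no crossings it is $+\infty$. The total resolution is the minimum of the angular and the crossing resolution. *)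

theory Defs
  imports "HOL-Analysis.Analysis"
begin

type_synonym point = "real^2"

definition left_nodes :: "nat \<Rightarrow> (nat + nat) set" where
  "left_nodes m = Inl ` {..<m}"

definition right_nodes :: "nat \<Rightarrow> (nat + nat) set" where
  "right_nodes n = Inr ` {..<n}"

definition complete_bipartite_edges :: "'v set \<Rightarrow> 'v set \<Rightarrow> 'v set set" where
  "complete_bipartite_edges V1 V2 = {{u, v} | u v. u \<in> V1 \<and> v \<in> V2}"

text \<open>A straight-line drawing is determined by the positions of the nodes: the edge
  \<open>{u, v}\<close> is drawn as \<open>closed_segment (p u) (p v)\<close>.\<close>

definition straight_line_drawing :: "'v set \<Rightarrow> ('v \<Rightarrow> point) \<Rightarrow> bool" where
  "straight_line_drawing V p \<longleftrightarrow> inj_on p V"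

definition is_line :: "point set \<Rightarrow> bool" where
  "is_line L \<longleftrightarrow> affine L \<and> aff_dim L = 1"

definition two_layered_drawing :: "'v set \<Rightarrow> 'v set \<Rightarrow> ('v \<Rightarrow> point) \<Rightarrow> bool" where
  "two_layered_drawing V1 V2 p \<longleftrightarrow>
     straight_line_drawing (V1 \<union> V2) p \<and>
     (\<exists>L1 L2. is_line L1 \<and> is_line L2 \<and> affine_parallel L1 L2 \<and> L1 \<noteq> L2 \<and>
              p ` V1 \<subseteq> L1 \<and> p ` V2 \<subseteq> L2)"

text \<open>The angle in \<open>[0, pi]\<close> at \<open>x\<close> between the rays towards \<open>a\<close> and \<open>b\<close>;
  meaningful only for \<open>a \<noteq> x\<close> and \<open>b \<noteq> x\<close>.\<close>

definition angle_at :: "point \<Rightarrow> point \<Rightarrow> point \<Rightarrow> real" where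
  "angle_at x a b = arccos (((a - x) \<bullet> (b - x)) / (norm (a - x) * norm (b - x)))"

definition node_angles :: "'v set set \<Rightarrow> ('v \<Rightarrow> point) \<Rightarrow> real set" where
  "node_angles E p =
     {angle_at (p v) (p a) (p b) | v a b. {v, a} \<in> E \<and> {v, b} \<in> E \<and> a \<noteq> b}"

text \<open>Two edges cross at \<open>x\<close> if they have no common end node and \<open>x\<close> is interior to both
  segments. The two angles below are the supplementary angles at the crossing.\<close>

definition crossing_angles :: "'v set set \<Rightarrow> ('v \<Rightarrow> point) \<Rightarrow> real set" where
  "crossing_angles E p =
     {min (angle_at x (p a) (p c)) (angle_at x (p a) (p d)) | x a b c d.
        {a, b} \<in> E \<and> {c, d} \<in> E \<and> {a, b} \<inter> {c, d} = {} \<and>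
        x \<in> open_segment (p a) (p b) \<and> x \<in> open_segment (p c) (p d)}"

text \<open>For a finite graph the infima below are minima, except that the infimum of the
  empty set in \<open>ereal\<close> is \<open>\<infinity>\<close>, as required when there are no crossings.\<close>

definition angular_resolution :: "'v set set \<Rightarrow> ('v \<Rightarrow> point) \<Rightarrow> ereal" where
  "angular_resolution E p = Inf (ereal ` node_angles E p)"

definition crossing_resolution :: "'v set set \<Rightarrow> ('v \<Rightarrow> point) \<Rightarrow> ereal" where
  "crossing_resolution E p = Inf (ereal ` crossing_angles E p)"

definition total_resolution :: "'v set set \<Rightarrow> ('v \<Rightarrow> point) \<Rightarrow> ereal" where
  "total_resolution E p = min (angular_resolution E p) (crossing_resolution E p)"

end

theory Submission
  imports Defs
begin

text \<open>With \<open>N = max m n\<close>, place the two classes at \<open>(i / N, 0)\<close> and \<open>(j / N, 1)\<close>. Every edge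
  direction then has the form \<open>(s, 1)\<close> where \<open>\<bar>s\<bar> \<le> 1\<close> and \<open>N s\<close> is an integer. Two edges
  with a common point have distinct slopes, so the sine of the angle between them, which is the
  cross product divided by the lengths, is at least \<open>(1 / N) / 2\<close>. The first two nodes of
  the layer of size \<open>N\<close> are seen from the first node of the other layer under the angle
  \<open>arctan (1 / N)\<close>.\<close>

section \<open>Angles and cross products in the plane\<close>

text \<open>Lagrange's identity in dimension two. Divided by its right-hand side, it becomes sin^2 +
  cos^2 = 1 for the angle between \<open>u\<close> and \<open>v\<close>.\<close>

lemma cross_sqr_real2:
  fixes u v :: "real^2"
  shows "(u $ 1 * v $ 2 - u $ 2 * v $ 1)\<^sup>2 + (u \<bullet> v)\<^sup>2 = (norm u * norm v)\<^sup>2"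
  unfolding power_mult_distrib power2_norm_eq_inner
  by (simp add: inner_vec_def sum_2 power2_eq_square algebra_simps)

text \<open>The quotient is the sine of the angle, and sin t \<le> t for t \<ge> 0. This covers
  obtuse angles as well.\<close>

lemma abs_cross_le_angle_at:
  assumes "a \<noteq> x" "b \<noteq> x"
  defines "u \<equiv> a - x" and "v \<equiv> b - x"
  shows "\<bar>u $ 1 * v $ 2 - u $ 2 * v $ 1\<bar> / (norm u * norm v) \<le> angle_at x a b"
proof -
  define c where "c = (u \<bullet> v) / (norm u * norm v)"
  have nz: "u \<noteq> 0" "v \<noteq> 0"
    using assms by simp_all
  then have pos: "norm u * norm v > 0"
    by simp
  have c: "\<bar>c\<bar> \<le> 1"
    using pos Cauchy_Schwarz_ineq2[of u v] by (simp add: c_def abs_mult)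
  have "1 - c\<^sup>2 = ((u $ 1 * v $ 2 - u $ 2 * v $ 1) / (norm u * norm v))\<^sup>2"
    using cross_sqr_real2[of u v] nz
    by (simp add: c_def power_divide divide_simps)
  then have "sin (arccos c) = \<bar>u $ 1 * v $ 2 - u $ 2 * v $ 1\<bar> / (norm u * norm v)"
    using c pos by (simp add: sin_arccos_abs abs_mult)
  moreover have "sin (arccos c) \<le> arccos c"
    using c by (intro sin_x_le_x arccos_lbound) auto
  ultimately show ?thesis
    by (simp add: angle_at_def c_def u_def v_def)
qed

text \<open>The sine does not change when \<open>u\<close> and \<open>v\<close> are scaled by
  nonzero factors, negative ones included. One estimate for the directions of two edges therefore
  serves both supplementary angles at a crossing.\<close>

lemma angle_at_ge_of_directions:
  fixes u v :: "real^2"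
  assumes a: "a - x = k *\<^sub>R u" "k \<noteq> 0" and b: "b - x = l *\<^sub>R v" "l \<noteq> 0"
    and "norm u \<le> r" "norm v \<le> r"
    and h: "h \<le> \<bar>u $ 1 * v $ 2 - u $ 2 * v $ 1\<bar>" "0 < h"
  shows "h / r\<^sup>2 \<le> angle_at x a b"
proof -
  have nz: "u \<noteq> 0" "v \<noteq> 0"
    using h by auto
  have "norm u * norm v \<le> r\<^sup>2"
    unfolding power2_eq_square using assms(5,6)
    by (intro mult_mono) (auto intro: order_trans[OF norm_ge_zero])
  then have "h / r\<^sup>2 \<le> \<bar>u $ 1 * v $ 2 - u $ 2 * v $ 1\<bar> / (norm u * norm v)"
    using h nz by (intro frac_le) auto
  also have "\<dots> = \<bar>(k * l) * (u $ 1 * v $ 2 - u $ 2 * v $ 1)\<bar> / (\<bar>k * l\<bar> * (norm u * norm v))"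
    using a(2) b(2) by (simp add: abs_mult)
  also have "\<dots> = \<bar>(a - x) $ 1 * (b - x) $ 2 - (a - x) $ 2 * (b - x) $ 1\<bar>
                    / (norm (a - x) * norm (b - x))"
    unfolding a(1) b(1) by (simp add: abs_mult algebra_simps)
  also have "\<dots> \<le> angle_at x a b"
    using a b nz by (intro abs_cross_le_angle_at) auto
  finally show ?thesis .
qed

lemma open_segment_directions:
  fixes a b :: "'a::real_vector"
  assumes "x \<in> open_segment a b"
  obtains t where "0 < t" "t < 1" "x = a + t *\<^sub>R (b - a)"
    "a - x = (- t) *\<^sub>R (b - a)" "b - x = (1 - t) *\<^sub>R (b - a)"
proof -
  from assms obtain t where "0 < t" "t < 1" "x = (1 - t) *\<^sub>R a + t *\<^sub>R b"
    by (auto simp: in_segment)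
  then show ?thesis
    by (intro that[of t]) (auto simp: algebra_simps)
qed

section \<open>The grid drawing and its edge directions\<close>

definition grid_pos :: "nat \<Rightarrow> nat + nat \<Rightarrow> point" where
  "grid_pos N v =
    (case v of Inl i \<Rightarrow> vector [real i / real N, 0] | Inr j \<Rightarrow> vector [real j / real N, 1])"

text \<open>Always oriented from the lower layer to the upper one, so that the second coordinate is
  1 and the first one is the slope \<open>s\<close> of the overview.\<close>

definition grid_dir :: "nat \<Rightarrow> nat \<Rightarrow> nat \<Rightarrow> real^2" where
  "grid_dir N i j = grid_pos N (Inr j) - grid_pos N (Inl i)"

lemma grid_pos_nth [simp]:
  "grid_pos N (Inl i) $ 1 = real i / real N" "grid_pos N (Inl i) $ 2 = 0"
  "grid_pos N (Inr j) $ 1 = real j / real N" "grid_pos N (Inr j) $ 2 = 1"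
  by (simp_all add: grid_pos_def)

lemma grid_dir_nth [simp]:
  "grid_dir N i j $ 1 = (real j - real i) / real N" "grid_dir N i j $ 2 = 1"
  by (simp_all add: grid_dir_def diff_divide_distrib)

lemma norm_grid_dir_le:
  assumes "i < N" "j < N"
  shows "norm (grid_dir N i j) \<le> sqrt 2"
proof -
  have "\<bar>real j - real i\<bar> \<le> real N"
    using assms by linarith
  then have "\<bar>(real j - real i) / real N\<bar> \<le> 1"
    using assms by (simp add: abs_divide)
  then have "((real j - real i) / real N)\<^sup>2 \<le> 1"
    by (simp add: abs_square_le_1)
  then show ?thesis
    by (simp add: norm_eq_sqrt_inner inner_vec_def sum_2 power2_eq_square)
qed

text \<open>As both second coordinates are 1, the cross product is the difference of two slopes: a
  nonzero integer divided by \<open>N\<close>. The differences of indices are taken in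
  \<open>int\<close> because subtraction on \<open>nat\<close> truncates.\<close>

lemma grid_dir_cross_ge:
  assumes "N > 0" "int j - int i \<noteq> int j' - int i'"
  shows "1 / real N \<le> \<bar>grid_dir N i j $ 1 * grid_dir N i' j' $ 2
                          - grid_dir N i j $ 2 * grid_dir N i' j' $ 1\<bar>"
proof -
  have "1 \<le> \<bar>(int j - int i) - (int j' - int i')\<bar>"
    using assms by linarith
  then have "real_of_int 1 \<le> real_of_int \<bar>(int j - int i) - (int j' - int i')\<bar>"
    by (simp only: of_int_le_iff)
  then have "1 / real N \<le> \<bar>(real j - real i) - (real j' - real i')\<bar> / real N"
    by (intro divide_right_mono) auto
  also have "\<dots> = \<bar>grid_dir N i j $ 1 * grid_dir N i' j' $ 2
                          - grid_dir N i j $ 2 * grid_dir N i' j' $ 1\<bar>"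
    by (simp add: diff_divide_distrib[symmetric])
  finally show ?thesis .
qed

text \<open>The factor \<open>1 / 2\<close> is \<open>1 / r\<^sup>2\<close> for the bound
  \<open>r = sqrt 2\<close> on the lengths of the directions.\<close>

lemma grid_angle_ge:
  assumes "i < N" "j < N" "i' < N" "j' < N" "int j - int i \<noteq> int j' - int i'"
    and "a - x = k *\<^sub>R grid_dir N i j" "k \<noteq> 0" "b - x = l *\<^sub>R grid_dir N i' j'" "l \<noteq> 0"
  shows "1 / 2 / real N \<le> angle_at x a b"
proof -
  have "1 / real N / (sqrt 2)\<^sup>2 \<le> angle_at x a b"
    using assms
    by (intro angle_at_ge_of_directions[OF assms(6-9)] norm_grid_dir_le grid_dir_cross_ge) auto
  then show ?thesis
    by (simp add: mult.commute)
qed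

section \<open>Lower bounds at nodes and crossings\<close>

lemma complete_bipartite_edgeE:
  assumes "{a, b} \<in> complete_bipartite_edges (left_nodes m) (right_nodes n)"
  obtains (lr) i j where "i < m" "j < n" "a = Inl i" "b = Inr j"
    | (rl) i j where "i < m" "j < n" "a = Inr j" "b = Inl i"
  using assms
  by (auto simp: complete_bipartite_edges_def left_nodes_def right_nodes_def doubleton_eq_iff)

lemma complete_bipartite_edgeI:
  assumes "i < m" "j < n"
  shows "{Inl i, Inr j} \<in> complete_bipartite_edges (left_nodes m) (right_nodes n)"
  using assms by (auto simp: complete_bipartite_edges_def left_nodes_def right_nodes_def
      doubleton_eq_iff)

lemma grid_node_angle_ge:
  assumes "m \<le> N" "n \<le> N"
    and va: "{v, a} \<in> complete_bipartite_edges (left_nodes m) (right_nodes n)"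
    and vb: "{v, b} \<in> complete_bipartite_edges (left_nodes m) (right_nodes n)"
    and "a \<noteq> b"
  shows "1 / 2 / real N \<le> angle_at (grid_pos N v) (grid_pos N a) (grid_pos N b)"
  using va
proof (cases rule: complete_bipartite_edgeE)
  case (lr i j)
  with vb obtain j' where "j' < n" "b = Inr j'"
    by (auto elim: complete_bipartite_edgeE)
  with lr assms show ?thesis
    \<comment> \<open>From a left node the edges leave along \<open>grid_dir\<close>, whence the
      factors 1; from a right node they run against it, whence -1 in the other case.\<close>
    by (intro grid_angle_ge[of i _ j i j' _ _ 1 _ 1]) (auto simp: grid_dir_def)
next
  case (rl i j)
  with vb obtain i' where "i' < m" "b = Inl i'"
    by (auto elim: complete_bipartite_edgeE)
  with rl assms show ?thesis
    by (intro grid_angle_ge[of i _ j i' j _ _ "-1" _ "-1"]) (auto simp: grid_dir_def)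
qed

text \<open>The last equation holds because \<open>grid_dir\<close> rises by exactly 1: the
  parameter of \<open>x\<close> on the edge is its height. Two edges through \<open>x\<close> thus
  share this parameter.\<close>

lemma grid_edge_directions:
  assumes e: "{a, b} \<in> complete_bipartite_edges (left_nodes m) (right_nodes n)"
    and x: "x \<in> open_segment (grid_pos N a) (grid_pos N b)"
  obtains i j k l where "i < m" "j < n" "{a, b} = {Inl i, Inr j}" "k \<noteq> 0" "l \<noteq> 0"
    "grid_pos N a - x = k *\<^sub>R grid_dir N i j" "grid_pos N b - x = l *\<^sub>R grid_dir N i j"
    "x = grid_pos N (Inl i) + (x $ 2) *\<^sub>R grid_dir N i j"
  using e
proof (cases rule: complete_bipartite_edgeE)
  case (lr i j)
  from x[unfolded lr] show ?thesis
  proof (rule open_segment_directions)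
    fix t
    assume t: "0 < t" "t < 1"
      "x = grid_pos N (Inl i) + t *\<^sub>R (grid_pos N (Inr j) - grid_pos N (Inl i))"
      "grid_pos N (Inl i) - x = - t *\<^sub>R (grid_pos N (Inr j) - grid_pos N (Inl i))"
      "grid_pos N (Inr j) - x = (1 - t) *\<^sub>R (grid_pos N (Inr j) - grid_pos N (Inl i))"
    have "x $ 2 = t"
      using t(3) by simp
    with t lr show ?thesis
      by (intro that[of i j "- t" "1 - t"]) (simp_all add: grid_dir_def)
  qed
next
  case (rl i j)
  from x[unfolded rl open_segment_commute[of _ "grid_pos N (Inl i)"]] show ?thesis
  proof (rule open_segment_directions)
    fix t
    assume t: "0 < t" "t < 1"
      "x = grid_pos N (Inl i) + t *\<^sub>R (grid_pos N (Inr j) - grid_pos N (Inl i))"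
      "grid_pos N (Inl i) - x = - t *\<^sub>R (grid_pos N (Inr j) - grid_pos N (Inl i))"
      "grid_pos N (Inr j) - x = (1 - t) *\<^sub>R (grid_pos N (Inr j) - grid_pos N (Inl i))"
    have "x $ 2 = t"
      using t(3) by simp
    with t rl show ?thesis
      by (intro that[of i j "1 - t" "- t"]) (simp_all add: grid_dir_def insert_commute)
  qed
qed

lemma grid_crossing_angle_ge:
  assumes "m \<le> N" "n \<le> N"
    and ab: "{a, b} \<in> complete_bipartite_edges (left_nodes m) (right_nodes n)"
    and cd: "{c, d} \<in> complete_bipartite_edges (left_nodes m) (right_nodes n)"
    and disj: "{a, b} \<inter> {c, d} = {}"
    and x: "x \<in> open_segment (grid_pos N a) (grid_pos N b)"
      "x \<in> open_segment (grid_pos N c) (grid_pos N d)"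
  shows "1 / 2 / real N \<le> min (angle_at x (grid_pos N a) (grid_pos N c))
                               (angle_at x (grid_pos N a) (grid_pos N d))"
proof -
  obtain i j k l where 1: "i < m" "j < n" "{a, b} = {Inl i, Inr j}" "k \<noteq> 0" "l \<noteq> 0"
    "grid_pos N a - x = k *\<^sub>R grid_dir N i j" "grid_pos N b - x = l *\<^sub>R grid_dir N i j"
    "x = grid_pos N (Inl i) + (x $ 2) *\<^sub>R grid_dir N i j"
    using grid_edge_directions[OF ab x(1)] .
  obtain i' j' k' l' where 2: "i' < m" "j' < n" "{c, d} = {Inl i', Inr j'}" "k' \<noteq> 0" "l' \<noteq> 0"
    "grid_pos N c - x = k' *\<^sub>R grid_dir N i' j'" "grid_pos N d - x = l' *\<^sub>R grid_dir N i' j'"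
    "x = grid_pos N (Inl i') + (x $ 2) *\<^sub>R grid_dir N i' j'"
    using grid_edge_directions[OF cd x(2)] .
  \<comment> \<open>With equal directions, going back from \<open>x\<close> by the common parameter
    \<open>x $ 2\<close> would lead both edges to the same left node, against
    \<open>disj\<close>.\<close>
  have slopes: "int j - int i \<noteq> int j' - int i'"
  proof
    assume "int j - int i = int j' - int i'"
    then have "real_of_int (int j - int i) = real_of_int (int j' - int i')"
      by (rule arg_cong)
    then have "grid_dir N i j = grid_dir N i' j'"
      by (simp add: vec_eq_iff forall_2)
    then have "grid_pos N (Inl i) = grid_pos N (Inl i')"
      using 1(8) 2(8) by (metis add_right_cancel)
    then have "real i / real N = real i' / real N"
      by (metis grid_pos_nth(1))
    then have "i = i'"
      \<comment> \<open>These facts give \<open>N > 0\<close>, so that the division can be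
        cancelled.\<close>
      using \<open>i < m\<close> \<open>m \<le> N\<close> by simp
    then show False
      using disj 1(3) 2(3) by auto
  qed
  have "i < N" "j < N" "i' < N" "j' < N"
    using 1 2 assms(1,2) by auto
  note ge = grid_angle_ge[OF this slopes 1(6) 1(4)]
  show ?thesis
    using ge[OF 2(6,4)] ge[OF 2(7,5)] by simp
qed

section \<open>The grid drawing is 2-layered\<close>

lemma inj_grid_pos:
  assumes "N > 0"
  shows "inj (grid_pos N)"
proof (rule injI)
  fix v w assume "grid_pos N v = grid_pos N w"
  then have "grid_pos N v $ 1 = grid_pos N w $ 1" "grid_pos N v $ 2 = grid_pos N w $ 2"
    by simp_all
  then show "v = w"
    using assms by (cases v; cases w) auto
qed

text \<open>A hyperplane with normal \<open>axis 2 1\<close> has affine dimension 2 - 1.\<close>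

lemma is_line_horizontal: "is_line {x :: point. x $ 2 = r}"
proof -
  have eq: "{x :: point. x $ 2 = r} = {x. axis 2 1 \<bullet> x = r}"
    by (simp add: inner_axis')
  show ?thesis
    unfolding is_line_def eq using affine_hyperplane aff_dim_hyperplane[of "axis 2 1 :: point" r]
    by (simp add: axis_eq_0_iff)
qed

lemma two_layered_grid_pos:
  assumes "N > 0"
  shows "two_layered_drawing (left_nodes m) (right_nodes n) (grid_pos N)"
proof -
  have "affine_parallel {x :: point. x $ 2 = 0} {x. x $ 2 = 1}"
    unfolding affine_parallel_def
  proof (intro exI[of _ "axis 2 1"] equalityI subsetI)
    fix y :: point assume "y \<in> {x. x $ 2 = 1}"
    then show "y \<in> (\<lambda>x. axis 2 1 + x) ` {x. x $ 2 = 0}"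
      by (intro image_eqI[of _ _ "y - axis 2 1"]) auto
  qed auto
  moreover have "axis 2 1 \<in> {x :: point. x $ 2 = 1} - {x. x $ 2 = 0}"
    by simp
  then have "{x :: point. x $ 2 = 0} \<noteq> {x. x $ 2 = 1}"
    by blast
  moreover have "grid_pos N ` left_nodes m \<subseteq> {x. x $ 2 = 0}"
    "grid_pos N ` right_nodes n \<subseteq> {x. x $ 2 = 1}"
    by (auto simp: left_nodes_def right_nodes_def)
  ultimately show ?thesis
    unfolding two_layered_drawing_def straight_line_drawing_def
    using is_line_horizontal inj_on_subset[OF inj_grid_pos[OF assms] subset_UNIV] by blast
qed

section \<open>A small angle at a node, and the theorem\<close>

text \<open>The left-hand side is \<open>arctan h\<close>, the angle opposite the leg
  \<open>h\<close> in a right triangle whose other leg is 1.\<close>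

lemma arccos_inverse_sqrt_le:
  fixes h :: real
  assumes "h \<ge> 0"
  shows "arccos (1 / sqrt (1 + h\<^sup>2)) \<le> h"
proof -
  have "arccos (1 / sqrt (1 + h\<^sup>2)) = arccos (cos (arctan h))"
    by (simp add: cos_arctan)
  also have "\<dots> = arctan h"
    using assms arctan_ubound[of h] pi_gt_zero by (intro arccos_cos) (simp, linarith)
  also have "\<dots> \<le> h"
    using assms by (rule arctan_le_self)
  finally show ?thesis .
qed

lemma grid_small_angles:
  shows "angle_at (grid_pos N (Inl 0)) (grid_pos N (Inr 0)) (grid_pos N (Inr 1)) \<le> 1 / real N"
    and "angle_at (grid_pos N (Inr 0)) (grid_pos N (Inl 0)) (grid_pos N (Inl 1)) \<le> 1 / real N"
  using arccos_inverse_sqrt_le[of "1 / real N"]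
  by (simp_all add: angle_at_def norm_eq_sqrt_inner inner_vec_def sum_2 power2_eq_square add.commute)

text \<open>Both layers have spacing \<open>1 / N\<close>, so either one yields the angle as soon as
  it has two nodes; if the right one does not, the left one does.\<close>

lemma grid_node_angle_le:
  assumes "1 \<le> m" "1 \<le> n" "2 \<le> max m n"
  shows "\<exists>\<theta> \<in> node_angles (complete_bipartite_edges (left_nodes m) (right_nodes n)) (grid_pos N).
           \<theta> \<le> 1 / real N"
proof (cases "2 \<le> n")
  case True
  then have "{Inl 0, Inr 0} \<in> complete_bipartite_edges (left_nodes m) (right_nodes n)"
    "{Inl 0, Inr 1} \<in> complete_bipartite_edges (left_nodes m) (right_nodes n)"
    using assms by (auto intro!: complete_bipartite_edgeI)
  then show ?thesis
    using grid_small_angles(1)[of N] unfolding node_angles_def by fastforce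
next
  case False
  then have "{Inr 0, Inl 0} \<in> complete_bipartite_edges (left_nodes m) (right_nodes n)"
    "{Inr 0, Inl 1} \<in> complete_bipartite_edges (left_nodes m) (right_nodes n)"
    using assms unfolding insert_commute[of "Inr 0"] by (auto intro!: complete_bipartite_edgeI)
  then show ?thesis
    using grid_small_angles(2)[of N] unfolding node_angles_def by fastforce
qed

theorem theorem2:
  shows "\<exists>c C :: real. 0 < c \<and> c \<le> C \<and>
    (\<forall>m n :: nat. 1 \<le> m \<longrightarrow> 1 \<le> n \<longrightarrow> 2 \<le> max m n \<longrightarrow>
      (\<exists>p :: nat + nat \<Rightarrow> point.
         two_layered_drawing (left_nodes m) (right_nodes n) p \<and>
         (let \<rho> = total_resolution
                     (complete_bipartite_edges (left_nodes m) (right_nodes n)) p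
          in ereal (c / real (max m n)) \<le> \<rho> \<and> \<rho> \<le> ereal (C / real (max m n)))))"
\<comment> \<open>\<open>1 / 2\<close> comes from the sine estimate and 1 from arctan (1 / N) \<le>
  1 / N.\<close>
proof (rule exI[of _ "1 / 2"], rule exI[of _ 1], intro conjI allI impI)
  fix m n :: nat
  assume mn: "1 \<le> m" "1 \<le> n" "2 \<le> max m n"
  define N where "N = max m n"
  define E where "E = complete_bipartite_edges (left_nodes m) (right_nodes n)"
  have le: "m \<le> N" "n \<le> N"
    by (auto simp: N_def)
  have "\<forall>\<theta> \<in> node_angles E (grid_pos N). 1 / 2 / real N \<le> \<theta>"
    using grid_node_angle_ge[OF le] unfolding node_angles_def E_def by blast
  then have "ereal (1 / 2 / real N) \<le> angular_resolution E (grid_pos N)"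
    unfolding angular_resolution_def by (intro Inf_greatest) auto
  moreover have "\<forall>\<theta> \<in> crossing_angles E (grid_pos N). 1 / 2 / real N \<le> \<theta>"
    using grid_crossing_angle_ge[OF le] unfolding crossing_angles_def E_def by blast
  then have "ereal (1 / 2 / real N) \<le> crossing_resolution E (grid_pos N)"
    \<comment> \<open>This includes drawings without crossings, where the infimum is
      \<infinity>.\<close>
    unfolding crossing_resolution_def by (intro Inf_greatest) auto
  \<comment> \<open>The total resolution is a minimum, so one small angle at a node bounds it from
    above.\<close>
  moreover have "angular_resolution E (grid_pos N) \<le> ereal (1 / real N)"
  proof -
    obtain \<theta> where "\<theta> \<in> node_angles E (grid_pos N)" "\<theta> \<le> 1 / real N"
      using grid_node_angle_le[OF mn] unfolding E_def by blast
    then show ?thesis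
      unfolding angular_resolution_def by (intro Inf_lower2[of "ereal \<theta>"]) auto
  qed
  ultimately show "\<exists>p. two_layered_drawing (left_nodes m) (right_nodes n) p \<and>
      (let \<rho> = total_resolution (complete_bipartite_edges (left_nodes m) (right_nodes n)) p
       in ereal (1 / 2 / real (max m n)) \<le> \<rho> \<and> \<rho> \<le> ereal (1 / real (max m n)))"
    using two_layered_grid_pos[of N m n] mn
    by (auto simp: total_resolution_def Let_def E_def N_def min.coboundedI1
        intro!: exI[of _ "grid_pos (max m n)"])
qed simp_all

end
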